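(* Let $n\ge 0$ be an integer, let $a_1\le\cdots\le a_n$ be real numbers, and let $p,q\ge 1$ be integers. For $x,y\in\mathbb{R}$ put $$K_n(x,y):=\exp[a_1,\dots,a_n,x^{(p)},y^{(q)}],$$ the divided difference of the exponential function at the $n+p+q$ nodes consisting of $a_1,\dots,a_n$, the node $x$ repeated $p$ times and the node $y$ repeated $q$ times. Then for all real $x_1\le x_2$ and $y_1\le y_2$, $$K_n(x_1,y_1)+K_n(x_2,y_2)\ \ge\ K_n(x_1,y_2)+K_n(x_2,y_1).$$
   Context: $\exp[z_0,\dots,z_m]$ denotes the divided difference of the function $e^x$ at the nodes $z_0,\dots,z_m$. It is symmetric in the nodes; for pairwise distinct nodes it equals $\sum_{i=0}^m e^{z_i}/\prod_{j\ne i}(z_i-z_j)$, and for repeated nodes it is defined by continuous extension, equivalently by the contour integral $\frac{1}{2\pi i}\oint_\Gamma \frac{e^z}{\prod_{i=0}^m (z-z_i)}\,dz$ with $\Gamma$ a positively oriented contour enclosing all nodes. Superscripts in parentheses indicate multiplicities of nodes. For $n=0$ there are no nodes $a_i$. *)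

theory Defs
  imports "HOL-Complex_Analysis.Complex_Analysis"
begin

text \<open>
  The divided difference of \<open>exp\<close> at a list of complex nodes (with repetitions), as a contour
  integral.  The circle about 0 is just one contour that encloses all nodes; by
  \<open>exp_dd_contour\<close> below, any other one gives the same value.  By \<open>exp_dd_distinct\<close> and
  \<open>exp_dd_continuous\<close> it is the continuous extension of the usual formula for distinct nodes.
\<close>

definition exp_dd :: "complex list \<Rightarrow> complex" where
  "exp_dd zs =
     1 / (2 * of_real pi * \<i>) *
     contour_integral (circlepath 0 (1 + (\<Sum>w\<leftarrow>zs. norm w))) (\<lambda>z. exp z / (\<Prod>w\<leftarrow>zs. z - w))"

text \<open>
  At real nodes the value is real (\<open>exp_dd_of_real\<close> below), so taking the real part loses nothing.
\<close>

definition exp_dd_real :: "real list \<Rightarrow> real" where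
  "exp_dd_real xs = Re (exp_dd (map of_real xs))"

definition exp_dd_kernel :: "real list \<Rightarrow> nat \<Rightarrow> nat \<Rightarrow> real \<Rightarrow> real \<Rightarrow> real" where
  "exp_dd_kernel a p q x y = exp_dd_real (a @ replicate p x @ replicate q y)"


subsection \<open>Agreement with the other descriptions of the divided difference\<close>

lemma norm_le_sum_list_norm:
  fixes zs :: "complex list"
  assumes "w \<in> set zs"
  shows "norm w \<le> (\<Sum>w\<leftarrow>zs. norm w)"
  using assms by (intro member_le_sum_list) auto

lemma contour_integral_exp_over_prod:
  assumes "valid_path g" "pathfinish g = pathstart g"
    and "path_image g \<inter> set zs = {}"
    and "\<And>w. w \<in> set zs \<Longrightarrow> winding_number g w = 1"
  shows "contour_integral g (\<lambda>z. exp z / (\<Prod>w\<leftarrow>zs. z - w)) =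
           2 * of_real pi * \<i> * (\<Sum>p\<in>set zs. residue (\<lambda>z. exp z / (\<Prod>w\<leftarrow>zs. z - w)) p)"
proof -
  let ?f = "\<lambda>z. exp z / (\<Prod>w\<leftarrow>zs. z - w)"
  have hol: "(\<lambda>z. \<Prod>w\<leftarrow>ws. z - w) holomorphic_on S" for ws :: "complex list" and S
    by (induction ws) (auto intro!: holomorphic_intros)
  have "contour_integral g ?f =
          2 * pi * \<i> * (\<Sum>p\<in>set zs. winding_number g p * residue ?f p)"
  proof (rule Residue_theorem[of UNIV])
    show "?f holomorphic_on UNIV - set zs"
      by (intro holomorphic_intros hol) (auto simp: prod_list_zero_iff)
  qed (use assms in auto)
  also have "(\<Sum>p\<in>set zs. winding_number g p * residue ?f p) = (\<Sum>p\<in>set zs. residue ?f p)"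
    using assms(4) by (intro sum.cong) auto
  finally show ?thesis
    by simp
qed

lemma contour_integral_exp_circle:
  assumes "\<And>w. w \<in> set zs \<Longrightarrow> norm w < r" "0 < r"
  shows "contour_integral (circlepath 0 r) (\<lambda>z. exp z / (\<Prod>w\<leftarrow>zs. z - w)) =
           2 * of_real pi * \<i> * (\<Sum>p\<in>set zs. residue (\<lambda>z. exp z / (\<Prod>w\<leftarrow>zs. z - w)) p)"
proof (rule contour_integral_exp_over_prod)
  show "path_image (circlepath 0 r) \<inter> set zs = {}"
    using assms by (fastforce simp: path_image_circlepath)
  show "winding_number (circlepath 0 r) w = 1" if "w \<in> set zs" for w
    using assms that by (intro winding_number_circlepath) auto
qed auto

lemma exp_dd_radius: "w \<in> set zs \<Longrightarrow> norm w < 1 + (\<Sum>w\<leftarrow>zs. norm w)" for w :: complex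
  using norm_le_sum_list_norm[of w zs] by linarith

lemma exp_dd_radius_pos: "0 < 1 + (\<Sum>w\<leftarrow>zs. norm w)" for zs :: "complex list"
proof -
  have "0 \<le> (\<Sum>w\<leftarrow>zs. norm w)"
    by (intro sum_list_nonneg) auto
  then show ?thesis by linarith
qed

lemma exp_dd_residues:
  "exp_dd zs = (\<Sum>p\<in>set zs. residue (\<lambda>z. exp z / (\<Prod>w\<leftarrow>zs. z - w)) p)"
  unfolding exp_dd_def
  by (subst contour_integral_exp_circle) (auto simp: exp_dd_radius exp_dd_radius_pos)

theorem exp_dd_contour:
  assumes "valid_path g" "pathfinish g = pathstart g"
    and "path_image g \<inter> set zs = {}"
    and "\<And>w. w \<in> set zs \<Longrightarrow> winding_number g w = 1"
  shows "exp_dd zs =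
           1 / (2 * of_real pi * \<i>) * contour_integral g (\<lambda>z. exp z / (\<Prod>w\<leftarrow>zs. z - w))"
  using contour_integral_exp_over_prod[OF assms] by (simp add: exp_dd_residues)

theorem exp_dd_symmetric:
  assumes "mset zs = mset ws"
  shows "exp_dd zs = exp_dd ws"
proof -
  have "(\<Prod>w\<leftarrow>zs. z - w) = (\<Prod>w\<leftarrow>ws. z - w)" for z
    using assms by (metis mset_map prod_mset_prod_list)
  moreover have "set zs = set ws"
    using assms by (rule mset_eq_setD)
  ultimately show ?thesis
    by (simp add: exp_dd_residues)
qed

theorem exp_dd_distinct:
  assumes "distinct zs"
  shows "exp_dd zs =
           (\<Sum>i<length zs. exp (zs ! i) / (\<Prod>j\<in>{..<length zs} - {i}. zs ! i - zs ! j))"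
proof -
  have "residue (\<lambda>z. exp z / (\<Prod>w\<leftarrow>zs. z - w)) p = exp p / (\<Prod>w\<in>set zs - {p}. p - w)"
    if p: "p \<in> set zs" for p
  proof -
    define s where "s = - (set zs - {p})"
    have "open s"
      unfolding s_def by (intro open_Compl finite_imp_closed) auto
    have eq: "(\<lambda>z. exp z / (\<Prod>w\<leftarrow>zs. z - w)) =
                (\<lambda>z. (exp z / (\<Prod>w\<in>set zs - {p}. z - w)) / (z - p))"
      using assms p
      by (auto simp: prod.distinct_set_conv_list[symmetric] prod.remove[of "set zs" p] mult.commute)
    show ?thesis
      unfolding eq
    proof (rule residue_simple)
      show "open s" by fact
      show "p \<in> s" by (simp add: s_def)
      show "(\<lambda>z. exp z / (\<Prod>w\<in>set zs - {p}. z - w)) holomorphic_on s"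
        by (intro holomorphic_intros) (auto simp: s_def)
    qed
  qed
  then have "exp_dd zs = (\<Sum>p\<in>set zs. exp p / (\<Prod>w\<in>set zs - {p}. p - w))"
    by (simp add: exp_dd_residues)
  also have "\<dots> = (\<Sum>i<length zs. exp (zs ! i) / (\<Prod>w\<in>set zs - {zs ! i}. zs ! i - w))"
    by (rule sum.reindex_bij_betw[symmetric, OF bij_betw_nth]) (use assms in auto)
  also have "\<dots> = (\<Sum>i<length zs. exp (zs ! i) / (\<Prod>j\<in>{..<length zs} - {i}. zs ! i - zs ! j))"
  proof (intro sum.cong refl arg_cong2[where f = "(/)"])
    fix i assume i: "i \<in> {..<length zs}"
    have "bij_betw ((!) zs) ({..<length zs} - {i}) (set zs - {zs ! i})"
      using i assms by (auto simp: bij_betw_def inj_on_def nth_eq_iff_index_eq in_set_conv_nth image_iff)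
    then show "(\<Prod>w\<in>set zs - {zs ! i}. zs ! i - w) = (\<Prod>j\<in>{..<length zs} - {i}. zs ! i - zs ! j)"
      by (rule prod.reindex_bij_betw[symmetric])
  qed
  finally show ?thesis .
qed

lemma bounded_prod_diff_sphere:
  "bounded ((\<lambda>z. \<Prod>w\<leftarrow>ws. z - w) ` sphere 0 r)" for ws :: "complex list"
proof (intro compact_imp_bounded compact_continuous_image)
  show "continuous_on (sphere 0 r) (\<lambda>z. \<Prod>w\<leftarrow>ws. z - w)"
    by (induction ws) (auto intro!: continuous_intros)
qed auto

theorem exp_dd_continuous:
  assumes len: "\<And>k. length (zs k) = length ws"
    and lim: "\<And>i. i < length ws \<Longrightarrow> ((\<lambda>k. zs k ! i) \<longlongrightarrow> ws ! i) F"
  shows "((\<lambda>k. exp_dd (zs k)) \<longlongrightarrow> exp_dd ws) F"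
proof (cases "F = bot")
  case nontrivial: False
  define r where "r = 2 + (\<Sum>w\<leftarrow>ws. norm w)"
  have r: "0 < r"
    using exp_dd_radius_pos[of ws] by (simp add: r_def)
  have rw: "norm w + 1 \<le> r" if "w \<in> set ws" for w
    using norm_le_sum_list_norm[OF that] by (simp add: r_def)
  have ul: "uniform_limit (sphere 0 r) (\<lambda>k z. \<Prod>w\<leftarrow>zs k. z - w) (\<lambda>z. \<Prod>w\<leftarrow>ws. z - w) F"
    using len lim
  proof (induction ws arbitrary: zs)
    case Nil
    then show ?case by (simp add: uniform_limit_const)
  next
    case (Cons w ws)
    have zs: "zs k = hd (zs k) # tl (zs k)" for k
      using Cons.prems(1)[of k] by (cases "zs k") auto
    have nth0: "zs k ! 0 = hd (zs k)" and nth1: "zs k ! Suc i = tl (zs k) ! i" for k i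
      using zs[of k] by (metis nth_Cons_0) (metis zs nth_Cons_Suc)
    have prod: "(\<Prod>w\<leftarrow>zs k. z - w) = (z - hd (zs k)) * (\<Prod>w\<leftarrow>tl (zs k). z - w)" for k z
      by (metis list.simps(9) prod_list.Cons zs)
    have hd: "((\<lambda>k. hd (zs k)) \<longlongrightarrow> w) F"
      using Cons.prems(2)[of 0] by (simp add: nth0)
    have tl: "((\<lambda>k. tl (zs k) ! i) \<longlongrightarrow> ws ! i) F" if "i < length ws" for i
      using Cons.prems(2)[of "Suc i"] that by (simp add: nth1)
    have "uniform_limit (sphere 0 r) (\<lambda>k z. (z - hd (zs k)) * (\<Prod>w\<leftarrow>tl (zs k). z - w))
            (\<lambda>z. (z - w) * (\<Prod>w\<leftarrow>ws. z - w)) F"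
    proof (rule uniform_lim_mult)
      show "uniform_limit (sphere 0 r) (\<lambda>k z. z - hd (zs k)) (\<lambda>z. z - w) F"
        using hd by (auto simp: uniform_limit_iff tendsto_iff dist_norm norm_minus_commute)
      show "uniform_limit (sphere 0 r) (\<lambda>k z. \<Prod>w\<leftarrow>tl (zs k). z - w) (\<lambda>z. \<Prod>w\<leftarrow>ws. z - w) F"
        using Cons.prems(1) tl by (intro Cons.IH) auto
      show "bounded ((\<lambda>z. z - w) ` sphere 0 r)"
        using bounded_prod_diff_sphere[of "[w]" r] by simp
      show "bounded ((\<lambda>z. \<Prod>w\<leftarrow>ws. z - w) ` sphere 0 r)"
        by (rule bounded_prod_diff_sphere)
    qed
    then show ?case by (simp add: prod)
  qed
  have low: "1 \<le> norm (\<Prod>w\<leftarrow>ws. z - w)" if z: "z \<in> sphere 0 r" for z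
    using rw
  proof (induction ws)
    case (Cons w ws)
    have "norm z = r" using z by simp
    then have "1 \<le> norm (z - w)"
      using Cons.prems[of w] norm_triangle_ineq2[of z w] by simp
    moreover have "1 \<le> norm (\<Prod>w\<leftarrow>ws. z - w)"
      using Cons by simp
    ultimately have "1 * 1 \<le> norm (z - w) * norm (\<Prod>w\<leftarrow>ws. z - w)"
      by (intro mult_mono) auto
    then show ?case
      by (simp add: norm_mult)
  qed auto
  have ul': "uniform_limit (sphere 0 r) (\<lambda>k z. exp z / (\<Prod>w\<leftarrow>zs k. z - w))
               (\<lambda>z. exp z / (\<Prod>w\<leftarrow>ws. z - w)) F"
  proof (rule uniform_lim_divide[OF uniform_limit_const ul])
    show "bounded (exp ` sphere (0::complex) r)"
      by (intro compact_imp_bounded compact_continuous_image continuous_intros) auto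
  qed (use low in auto)
  have circ: "exp_dd us = 1 / (2 * of_real pi * \<i>) *
                contour_integral (circlepath 0 r) (\<lambda>z. exp z / (\<Prod>w\<leftarrow>us. z - w))"
    if "\<And>w. w \<in> set us \<Longrightarrow> norm w < r" for us
    using contour_integral_exp_circle[of us r] that r by (simp add: exp_dd_residues)
  have "\<forall>\<^sub>F k in F. norm (zs k ! i) < r" if "i < length ws" for i
  proof (rule order_tendstoD(2)[OF tendsto_norm[OF lim[OF that]]])
    show "norm (ws ! i) < r"
      using rw[of "ws ! i"] that by simp
  qed
  then have "\<forall>\<^sub>F k in F. \<forall>i\<in>{..<length ws}. norm (zs k ! i) < r"
    by (intro eventually_ball_finite) auto
  then have ev: "\<forall>\<^sub>F k in F. \<forall>w\<in>set (zs k). norm w < r"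
    by eventually_elim (auto simp: in_set_conv_nth len)
  have "((\<lambda>k. contour_integral (circlepath 0 r) (\<lambda>z. exp z / (\<Prod>w\<leftarrow>zs k. z - w))) \<longlongrightarrow>
           contour_integral (circlepath 0 r) (\<lambda>z. exp z / (\<Prod>w\<leftarrow>ws. z - w))) F"
  proof (rule contour_integral_uniform_limit_circlepath(2)[OF _ ul' nontrivial r])
    show "\<forall>\<^sub>F k in F. (\<lambda>z. exp z / (\<Prod>w\<leftarrow>zs k. z - w)) contour_integrable_on circlepath 0 r"
      using ev
    proof eventually_elim
      case (elim k)
      have "continuous_on (sphere 0 r) (\<lambda>z. \<Prod>w\<leftarrow>us. z - w)" for us :: "complex list"
        by (induction us) (auto intro!: continuous_intros)
      then have "continuous_on (sphere 0 r) (\<lambda>z. exp z / (\<Prod>w\<leftarrow>zs k. z - w))"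
        using elim by (intro continuous_intros) (auto simp: prod_list_zero_iff)
      then show ?case
        using r by (intro contour_integrable_continuous_circlepath) (auto simp: path_image_circlepath)
    qed
  qed
  then have "((\<lambda>k. 1 / (2 * of_real pi * \<i>) *
                contour_integral (circlepath 0 r) (\<lambda>z. exp z / (\<Prod>w\<leftarrow>zs k. z - w))) \<longlongrightarrow> exp_dd ws) F"
    using rw by (subst circ[of ws]) (force intro!: tendsto_intros)+
  moreover have "\<forall>\<^sub>F k in F. 1 / (2 * of_real pi * \<i>) *
      contour_integral (circlepath 0 r) (\<lambda>z. exp z / (\<Prod>w\<leftarrow>zs k. z - w)) = exp_dd (zs k)"
    using ev by eventually_elim (auto simp: circ)
  ultimately show ?thesis
    by (rule Lim_transform_eventually)
qed simp

theorem exp_dd_of_real: "exp_dd (map of_real xs) = of_real (exp_dd_real xs)"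
proof -
  define zs where "zs = map complex_of_real xs"
  define r where "r = 1 + (\<Sum>w\<leftarrow>zs. norm w)"
  define f where "f = (\<lambda>z. exp z / (\<Prod>w\<leftarrow>zs. z - w))"
  have "cnj (\<Prod>w\<leftarrow>zs. cnj z - w) = (\<Prod>w\<leftarrow>zs. z - w)" for z
    unfolding zs_def by (induction xs) auto
  then have f: "cnj \<circ> f \<circ> cnj = f"
    by (auto simp: f_def exp_cnj)
  have circ: "cnj \<circ> circlepath 0 r = reversepath (circlepath 0 r)"
  proof
    fix t :: real
    have "cis (2 * pi * (1 - t)) = cnj (cis (2 * pi * t))"
      by (simp add: complex_eq_iff right_diff_distrib)
    then show "(cnj \<circ> circlepath 0 r) t = reversepath (circlepath 0 r) t"
      by (simp add: circlepath reversepath_def cis_conv_exp algebra_simps flip: exp_cnj)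
  qed
  have "cnj (contour_integral (circlepath 0 r) f) = - contour_integral (circlepath 0 r) f"
    using contour_integral_cnj[of "circlepath 0 r" f]
    by (simp add: f circ contour_integral_reversepath)
  then have "cnj (exp_dd zs) = exp_dd zs"
    by (simp add: exp_dd_def f_def r_def)
  then show ?thesis
    by (simp add: exp_dd_real_def zs_def complex_eq_iff)
qed

end

theory Submission
  imports Defs
begin

text \<open>
  Replacing the nodes \<open>x1\<close> by \<open>x2\<close> one at a time, and likewise \<open>y1\<close> by \<open>y2\<close>, the identity
  \<open>exp[u, ws] - exp[v, ws] = (u - v) exp[u, v, ws]\<close> writes the mixed difference of the kernel as
  \<open>(x2 - x1) (y2 - y1)\<close> times a sum of divided differences of \<open>exp\<close> at real nodes.  These are
  nonnegative: for \<open>G(xs, t)\<close>, the divided difference of \<open>z \<mapsto> exp (t z)\<close> at the nodes \<open>xs\<close>,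
  adding a node \<open>x\<close> gives \<open>(exp (-t x) G((x, xs), t))' = exp (-t x) G(xs, t)\<close>, and at \<open>t = 0\<close> the divided
  difference of the constant 1 at two or more nodes vanishes.
\<close>

section \<open>Divided differences as integrals over a fixed circle\<close>

text \<open>For entire \<open>f\<close> and nodes inside the circle this is the divided difference
  of \<open>f\<close>. The radius does not depend on the nodes, so that integrals for different node
  lists can be combined; \<open>f\<close> varies because \<open>exp (t * z)\<close>, its derivative
  in \<open>t\<close> and the constant 1 all occur.\<close>

definition circle_dd :: "real \<Rightarrow> (complex \<Rightarrow> complex) \<Rightarrow> complex list \<Rightarrow> complex" where
  "circle_dd r f zs =
     1 / (2 * of_real pi * \<i>) *
     contour_integral (circlepath 0 r) (\<lambda>z. f z / (\<Prod>w\<leftarrow>zs. z - w))"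

lemma circle_dd_exp:
  assumes "set zs \<subseteq> ball 0 r" "0 < r"
  shows "circle_dd r exp zs = exp_dd zs"
  unfolding circle_dd_def exp_dd_residues
  by (subst contour_integral_exp_circle) (use assms in auto)

lemma circle_dd_cong_mset:
  assumes "mset zs = mset ws"
  shows "circle_dd r f zs = circle_dd r f ws"
proof -
  have "(\<Prod>w\<leftarrow>zs. z - w) = (\<Prod>w\<leftarrow>ws. z - w)" for z
    using assms by (metis mset_map prod_mset_prod_list)
  then show ?thesis
    by (simp add: circle_dd_def)
qed

lemma continuous_on_prod_diff [continuous_intros]:
  "continuous_on S (\<lambda>z. \<Prod>w\<leftarrow>ws. z - w)" for ws :: "complex list"
  by (induction ws) (auto intro!: continuous_intros)

lemma prod_diff_sphere_nonzero:
  fixes zs :: "complex list"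
  assumes "set zs \<subseteq> ball 0 r" "z \<in> sphere 0 r"
  shows "(\<Prod>w\<leftarrow>zs. z - w) \<noteq> 0"
  using assms by (auto simp: prod_list_zero_iff)

lemma contour_integrable_dd:
  assumes "continuous_on (sphere 0 r) f" "set zs \<subseteq> ball 0 r" "0 < r"
  shows "(\<lambda>z. f z / (\<Prod>w\<leftarrow>zs. z - w)) contour_integrable_on circlepath 0 r"
proof (rule contour_integrable_continuous_circlepath)
  show "continuous_on (path_image (circlepath 0 r)) (\<lambda>z. f z / (\<Prod>w\<leftarrow>zs. z - w))"
    using assms prod_diff_sphere_nonzero[OF assms(2)]
    by (auto simp: path_image_circlepath intro!: continuous_intros)
qed

text \<open>Partial fractions under the integral: 1/(z - u) - 1/(z - v) = (u - v)/((z - u)(z - v)).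
  The case u = v is included.\<close>

lemma circle_dd_diff:
  assumes "continuous_on (sphere 0 r) f" "set (u # v # ws) \<subseteq> ball 0 r" "0 < r"
  shows "circle_dd r f (u # ws) - circle_dd r f (v # ws) = (u - v) * circle_dd r f (u # v # ws)"
proof -
  let ?c = "circlepath 0 r"
  let ?g = "\<lambda>zs z. f z / (\<Prod>w\<leftarrow>zs. z - w)"
  have int: "?g zs contour_integrable_on ?c" if "set zs \<subseteq> set (u # v # ws)" for zs
    using that assms by (intro contour_integrable_dd) auto
  have "contour_integral ?c (?g (u # ws)) - contour_integral ?c (?g (v # ws)) =
          contour_integral ?c (\<lambda>z. ?g (u # ws) z - ?g (v # ws) z)"
    by (rule contour_integral_diff[symmetric]; rule int; auto)
  also have "\<dots> = contour_integral ?c (\<lambda>z. (u - v) * ?g (u # v # ws) z)"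
  proof (rule contour_integral_cong[OF refl])
    fix z assume "z \<in> path_image ?c"
    then have "z - u \<noteq> 0" "z - v \<noteq> 0"  "(\<Prod>w\<leftarrow>ws. z - w) \<noteq> 0"
      using assms prod_diff_sphere_nonzero[of ws r z] by (auto simp: path_image_circlepath)
    moreover have "f z / (a * c) - f z / (b * c) = (b - a) * (f z / (a * (b * c)))"
      if "a \<noteq> 0" "b \<noteq> 0" "c \<noteq> 0" for a b c
      using that by (simp add: field_simps)
    ultimately show "?g (u # ws) z - ?g (v # ws) z = (u - v) * ?g (u # v # ws) z"
      by simp
  qed
  also have "\<dots> = (u - v) * contour_integral ?c (?g (u # v # ws))"
    by (intro contour_integral_lmul int) auto
  finally show ?thesis
    by (simp add: circle_dd_def flip: diff_divide_distrib)
qed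

section \<open>Divided differences of the constant 1\<close>

lemma circle_dd_singleton:
  assumes "f holomorphic_on cball 0 r" "w \<in> ball 0 r"
  shows "circle_dd r f [w] = f w"
  using Cauchy_integral_circlepath_simple[OF assms(1), of w] assms(2)
  by (simp add: circle_dd_def contour_integral_unique)

text \<open>By Cauchy's formula, a pole of order n at \<open>w\<close> picks out a multiple of the
  derivative of order n - 1 of the numerator, which vanishes for a constant once n is at least
  2.\<close>

lemma circle_dd_const_replicate:
  assumes "w \<in> ball 0 r" "2 \<le> n"
  shows "circle_dd r (\<lambda>_. 1) (replicate n w) = 0"
proof -
  obtain k where n: "n = Suc (Suc k)"
    using assms(2) by (metis Suc_le_D numeral_2_eq_2 Suc_le_mono)
  have eq: "(\<Prod>v\<leftarrow>replicate n w. z - v) = (z - w) ^ Suc (Suc k)" for z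
    unfolding n by (induction k) auto
  have "((\<lambda>u. 1 / (u - w) ^ Suc (Suc k)) has_contour_integral
          (2 * pi * \<i>) / fact (Suc k) * (deriv ^^ Suc k) (\<lambda>_. 1) w) (circlepath 0 r)"
    using assms by (intro Cauchy_has_contour_integral_higher_derivative_circlepath) auto
  moreover have "(deriv ^^ Suc k) (\<lambda>_. 1) w = (0 :: complex)"
    by (simp add: higher_deriv_const del: funpow.simps)
  ultimately have "contour_integral (circlepath 0 r) (\<lambda>u. 1 / (u - w) ^ Suc (Suc k)) = 0"
    by (metis contour_integral_unique mult_zero_right)
  then show ?thesis
    by (simp only: circle_dd_def eq mult_zero_right)
qed

text \<open>Induction on the number of nodes. If two nodes u and v differ,
  \<open>circle_dd_diff\<close> reduces the claim to the lists that lack one of them, and u - v can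
  be cancelled; if all nodes agree, \<open>circle_dd_const_replicate\<close> applies.\<close>

lemma circle_dd_const:
  assumes "set zs \<subseteq> ball 0 r" "0 < r" "2 \<le> length zs"
  shows "circle_dd r (\<lambda>_. 1) zs = 0"
  using assms(1,3)
proof (induction "length zs" arbitrary: zs rule: less_induct)
  case less
  have one: "circle_dd r (\<lambda>_. 1) [w] = 1" if "w \<in> set zs" for w
    using that less.prems by (subst circle_dd_singleton) auto
  obtain u us where zs: "zs = u # us"
    using less.prems by (cases zs) auto
  show ?case
  proof (cases "\<exists>v\<in>set us. v \<noteq> u")
    case True
    then obtain v where v: "v \<in> set us" "v \<noteq> u"
      by blast
    then obtain us1 us2 where us: "us = us1 @ v # us2"
      by (meson split_list)
    define ws where "ws = us1 @ us2"
    have mset: "mset zs = mset (u # v # ws)"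
      by (simp add: zs us ws_def)
    then have set: "set zs = set (u # v # ws)"
      by (rule mset_eq_setD)
    have len: "length zs = length (u # v # ws)"
      using mset by (rule mset_eq_length)
    \<comment> \<open>Both sides are 1 if no further node is left, and both are 0 by induction
      otherwise.\<close>
    have "circle_dd r (\<lambda>_. 1) (u # ws) = circle_dd r (\<lambda>_. 1) (v # ws)"
    proof (cases "ws = []")
      case True
      then show ?thesis
        using one[of u] one[of v] set by simp
    next
      case False
      then have "2 \<le> length (w # ws)" for w
        by (cases ws) auto
      then have "circle_dd r (\<lambda>_. 1) (w # ws) = 0" if "w \<in> {u, v}" for w
        using that less.prems len by (intro less.hyps) (auto simp: set)
      then show ?thesis by simp
    qed
    then have "(u - v) * circle_dd r (\<lambda>_. 1) (u # v # ws) = 0"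
      using circle_dd_diff[of r "\<lambda>_. 1" u v ws] less.prems assms(2) set by simp
    then show ?thesis
      using v circle_dd_cong_mset[OF mset] by simp
  next
    case False
    then have "zs = replicate (length zs) u"
      by (simp add: zs replicate_length_same)
    then show ?thesis
      using circle_dd_const_replicate[of u r "length zs"] less.prems zs by simp
  qed
qed

section \<open>Growth in \<open>t\<close> and nonnegativity at real nodes\<close>

text \<open>Differentiation under the integral sign, after parametrising the circle over the unit
  interval; the denominator \<open>P\<close> has no zero there.\<close>

lemma circle_dd_has_field_derivative:
  assumes "set zs \<subseteq> ball 0 r" "0 < r"
  shows "((\<lambda>t. circle_dd r (\<lambda>z. exp (t * z)) zs) has_field_derivative
           circle_dd r (\<lambda>z. z * exp (t * z)) zs) (at t)"
proof -
  define c where "c = circlepath 0 r"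
  define c' where "c' = (\<lambda>s. vector_derivative c (at s))"
  define P where "P = (\<lambda>s. \<Prod>w\<leftarrow>zs. c s - w)"
  have c: "c s \<in> sphere 0 r" for s
    using assms(2) by (simp add: c_def circlepath norm_mult)
  have P: "P s \<noteq> 0" for s
    using prod_diff_sphere_nonzero[OF assms(1) c] by (simp add: P_def)
  have cont: "continuous_on S c" "continuous_on S c'" for S
    unfolding c'_def c_def vector_derivative_circlepath
    by (auto simp: circlepath intro!: continuous_intros)
  have contP: "continuous_on S P" for S
    unfolding P_def
    using continuous_on_compose2[OF continuous_on_prod_diff[of UNIV zs] cont(1)] by auto
  have "((\<lambda>t. integral (cbox 0 1) (\<lambda>s. exp (t * c s) / P s * c' s)) has_field_derivative
          integral (cbox 0 1) (\<lambda>s. c s * exp (t * c s) / P s * c' s)) (at t within UNIV)"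
  proof (rule leibniz_rule_field_derivative)
    show "((\<lambda>t. exp (t * c s) / P s * c' s) has_field_derivative
            c s * exp (t * c s) / P s * c' s) (at t within UNIV)" for t s
      by (auto intro!: derivative_eq_intros simp: P)
    show "(\<lambda>s. exp (t * c s) / P s * c' s) integrable_on cbox 0 1" for t
      by (intro integrable_continuous continuous_intros cont contP) (simp add: P)
    have "continuous_on (UNIV \<times> cbox 0 1) (\<lambda>x. c (snd x))"
       "continuous_on (UNIV \<times> cbox 0 1) (\<lambda>x. c' (snd x))"
       "continuous_on (UNIV \<times> cbox 0 1) (\<lambda>x. P (snd x))"
      using continuous_on_compose2[OF cont(1)[of UNIV] continuous_on_snd[OF continuous_on_id]]
        continuous_on_compose2[OF cont(2)[of UNIV] continuous_on_snd[OF continuous_on_id]]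
        continuous_on_compose2[OF contP[of UNIV] continuous_on_snd[OF continuous_on_id]]
      by auto
    then show "continuous_on (UNIV \<times> cbox 0 1) (\<lambda>(t, s). c s * exp (t * c s) / P s * c' s)"
      unfolding case_prod_unfold by (intro continuous_intros) (simp_all add: P)
  qed auto
  then show ?thesis
    unfolding circle_dd_def contour_integral_integral
    by (auto simp: c_def c'_def P_def intro!: DERIV_cdivide)
qed

text \<open>Since z/(z - x) = 1 + x/(z - x), the derivative in \<open>t\<close> becomes the
  right-hand side of a first-order linear differential equation.\<close>

lemma circle_dd_exp_ode:
  assumes "set (x # zs) \<subseteq> ball 0 r" "0 < r"
  shows "circle_dd r (\<lambda>z. z * exp (t * z)) (x # zs) =
           circle_dd r (\<lambda>z. exp (t * z)) zs + x * circle_dd r (\<lambda>z. exp (t * z)) (x # zs)"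
proof -
  let ?c = "circlepath 0 r"
  let ?g = "\<lambda>zs z. exp (t * z) / (\<Prod>w\<leftarrow>zs. z - w)"
  have int: "?g ws contour_integrable_on ?c" if "set ws \<subseteq> set (x # zs)" for ws
    using that assms by (intro contour_integrable_dd continuous_intros) auto
  have "contour_integral ?c (\<lambda>z. z * exp (t * z) / (\<Prod>w\<leftarrow>x # zs. z - w)) =
          contour_integral ?c (\<lambda>z. ?g zs z + x * ?g (x # zs) z)"
  proof (rule contour_integral_cong[OF refl])
    fix z assume "z \<in> path_image ?c"
    then have "z - x \<noteq> 0" "(\<Prod>w\<leftarrow>zs. z - w) \<noteq> 0"
      using assms prod_diff_sphere_nonzero[of zs r z] by (auto simp: path_image_circlepath)
    then show "z * exp (t * z) / (\<Prod>w\<leftarrow>x # zs. z - w) = ?g zs z + x * ?g (x # zs) z"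
      by (simp add: field_simps)
  qed
  also have "\<dots> = contour_integral ?c (?g zs) + contour_integral ?c (\<lambda>z. x * ?g (x # zs) z)"
    by (intro contour_integral_add contour_integrable_lmul int) auto
  also have "contour_integral ?c (\<lambda>z. x * ?g (x # zs) z) =
      x * contour_integral ?c (?g (x # zs))"
    by (intro contour_integral_lmul int) auto
  finally show ?thesis
    by (simp add: circle_dd_def algebra_simps)
qed

text \<open>Induction on the nodes, with \<open>t\<close> arbitrary because the derivative at every
  s between 0 and t needs the hypothesis at s. A single node gives a value of the
  exponential.\<close>

lemma Re_circle_dd_exp_nonneg:
  fixes xs :: "real list"
  assumes "set (map of_real xs) \<subseteq> ball (0 :: complex) r" "0 < r" "xs \<noteq> []" "0 \<le> t"
  shows "0 \<le> Re (circle_dd r (\<lambda>z. exp (of_real t * z)) (map of_real xs))"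
  using assms(3,1,4)
proof (induction xs arbitrary: t rule: list_nonempty_induct)
  case (single x)
  have "circle_dd r (\<lambda>z. exp (of_real t * z)) [of_real x] = exp (of_real t * of_real x)"
    using single by (intro circle_dd_singleton holomorphic_intros) auto
  then show ?case
    by (simp add: exp_of_real flip: of_real_mult)
next
  case (cons x xs)
  let ?G = "\<lambda>ys t. circle_dd r (\<lambda>z. exp (t * z)) (map of_real ys)"
  \<comment> \<open>The factor exp (-t x) is the integrating factor: it cancels the term
    \<open>of_real x * ?G (x # xs)\<close> of the differential equation.\<close>
  define h where "h = (\<lambda>t. Re (exp (- of_real t * of_real x) * ?G (x # xs) (of_real t)))"
  have h: "h t = exp (- t * x) * Re (?G (x # xs) (of_real t))" for t
    by (simp add: h_def exp_of_real flip: of_real_mult of_real_minus)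
  have "h 0 \<le> h t"
  proof (rule DERIV_nonneg_imp_nondecreasing[OF cons.prems(2)])
    fix s assume s: "0 \<le> s" "s \<le> t"
    have "((\<lambda>t. exp (- t * of_real x)) has_field_derivative
            - of_real x * exp (- of_real s * of_real x)) (at (of_real s :: complex))"
      by (auto intro!: derivative_eq_intros)
    moreover have "(?G (x # xs) has_field_derivative ?G xs (of_real s) + of_real x * ?G (x # xs) (of_real s))
            (at (of_real s))"
      using circle_dd_has_field_derivative[OF cons.prems(1) assms(2)]
        circle_dd_exp_ode[OF cons.prems(1)[unfolded list.map] assms(2)]
      by simp
    ultimately have "((\<lambda>t. exp (- t * of_real x) * ?G (x # xs) t) has_field_derivative
             exp (- of_real s * of_real x) * ?G xs (of_real s)) (at (of_real s))"
      by (rule DERIV_cong[OF DERIV_mult]) (simp only: algebra_simps, simp)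
    from has_vector_derivative_real_field[OF this]
    have "(h has_real_derivative Re (exp (- of_real s * of_real x) * ?G xs (of_real s))) (at s)"
      unfolding h_def has_real_derivative_iff_has_vector_derivative
      by (rule bounded_linear.has_vector_derivative[OF bounded_linear_Re, unfolded o_def])
    moreover have "Re (exp (- of_real s * of_real x) * ?G xs (of_real s)) =
        exp (- s * x) * Re (?G xs (of_real s))"
      by (simp add: exp_of_real flip: of_real_mult of_real_minus)
    moreover have "0 \<le> Re (?G xs (of_real s))"
      using cons s by auto
    ultimately show "\<exists>y. (h has_real_derivative y) (at s) \<and> 0 \<le> y"
      by fastforce
  qed
  \<comment> \<open>At t = 0 the integrand's numerator is 1, and \<open>x # xs\<close> has at least
    two nodes because \<open>xs\<close> is nonempty.\<close>
  moreover have "h 0 = 0"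
    using circle_dd_const[of "map of_real (x # xs)" r] cons assms(2)
    by (cases xs) (auto simp: h)
  ultimately show ?case
    by (simp add: h zero_le_mult_iff)
qed

section \<open>Real divided differences of exp and the kernel\<close>

lemma set_subset_ball_exp_dd_radius:
  "set zs \<subseteq> ball 0 (1 + (\<Sum>w\<leftarrow>zs. norm w))" for zs :: "complex list"
  using exp_dd_radius[of _ zs] by auto

lemma exp_dd_real_nonneg:
  assumes "xs \<noteq> []"
  shows "0 \<le> exp_dd_real xs"
proof -
  let ?zs = "map complex_of_real xs"
  let ?r = "1 + (\<Sum>w\<leftarrow>?zs. norm w)"
  have "set ?zs \<subseteq> ball 0 ?r"
    by (rule set_subset_ball_exp_dd_radius)
  then show ?thesis
    using Re_circle_dd_exp_nonneg[of xs ?r 1] circle_dd_exp[of ?zs ?r] exp_dd_radius_pos[of ?zs]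
      assms by (simp add: exp_dd_real_def)
qed

lemma exp_dd_real_diff:
  "exp_dd_real (u # ws) - exp_dd_real (v # ws) = (u - v) * exp_dd_real (u # v # ws)"
proof -
  let ?zs = "map complex_of_real (u # v # ws)"
  \<comment> \<open>The radius is taken from the longest of the three lists, so that one circle
    serves them all.\<close>
  define r where "r = 1 + (\<Sum>w\<leftarrow>?zs. norm w)"
  have *: "set ?zs \<subseteq> ball 0 r"
    unfolding r_def by (rule set_subset_ball_exp_dd_radius)
  have r: "0 < r"
    unfolding r_def by (rule exp_dd_radius_pos)
  have e: "circle_dd r exp zs = exp_dd zs" if "set zs \<subseteq> set ?zs" for zs
    by (rule circle_dd_exp[OF subset_trans[OF that *] r])
  have "exp_dd (map of_real (u # ws)) - exp_dd (map of_real (v # ws)) =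
      of_real (u - v) * exp_dd ?zs"
    using circle_dd_diff[of r exp "of_real u" "of_real v" "map of_real ws"] * r
    by (simp add: e subset_insertI2 continuous_on_exp)
  then show ?thesis
    by (metis (mono_tags) exp_dd_of_real of_real_diff of_real_eq_iff of_real_mult)
qed

lemma exp_dd_real_cong_mset:
  "mset xs = mset ys \<Longrightarrow> exp_dd_real xs = exp_dd_real ys"
  unfolding exp_dd_real_def by (metis exp_dd_symmetric mset_map)

text \<open>Telescoping sum: the copies of u are exchanged for v one at a time. Each exchange adds a
  node, hence n + 1 copies of u and v in every summand.\<close>

lemma exp_dd_real_replicate_diff:
  "exp_dd_real (replicate n u @ ws) - exp_dd_real (replicate n v @ ws) =
     (u - v) * (\<Sum>i<n. exp_dd_real (replicate (n - i) u @ replicate (Suc i) v @ ws))"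
proof -
  define F where "F = (\<lambda>i. exp_dd_real (replicate (n - i) u @ replicate i v @ ws))"
  have "F i - F (Suc i) = (u - v) * exp_dd_real (replicate (n - i) u @ replicate (Suc i) v @ ws)"
    if "i < n" for i
  proof -
    let ?r = "replicate (n - Suc i) u @ replicate i v @ ws"
    have n: "replicate (n - i) u = u # replicate (n - Suc i) u"
      using that by (metis Suc_diff_Suc replicate_Suc)
    have "F i = exp_dd_real (u # ?r)" "F (Suc i) = exp_dd_real (v # ?r)"
      "exp_dd_real (replicate (n - i) u @ replicate (Suc i) v @ ws) = exp_dd_real (u # v # ?r)"
      unfolding F_def n by (auto intro!: exp_dd_real_cong_mset)
    then show ?thesis
      using exp_dd_real_diff[of u ?r v] by simp
  qed
  moreover have "(\<Sum>i<n. F i - F (Suc i)) = F 0 - F n"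
    by (rule sum_lessThan_telescope')
  ultimately have "F 0 - F n =
      (u - v) * (\<Sum>i<n. exp_dd_real (replicate (n - i) u @ replicate (Suc i) v @ ws))"
    by (simp add: sum_distrib_left)
  then show ?thesis
    by (simp add: F_def)
qed

lemma exp_dd_real_replicate_mono:
  assumes "v \<le> u"
  shows "exp_dd_real (replicate n v @ ws) \<le> exp_dd_real (replicate n u @ ws)"
proof -
  have "0 \<le> (u - v) * (\<Sum>i<n. exp_dd_real (replicate (n - i) u @ replicate (Suc i) v @ ws))"
    using assms by (intro mult_nonneg_nonneg sum_nonneg exp_dd_real_nonneg) auto
  then show ?thesis
    using exp_dd_real_replicate_diff[of n u ws v] by linarith
qed

theorem theorem2:
  fixes a :: "real list" and p q :: nat and x1 x2 y1 y2 :: real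
  assumes "sorted a"
    and "p \<ge> 1" and "q \<ge> 1"
    and "x1 \<le> x2" and "y1 \<le> y2"
  shows "exp_dd_kernel a p q x1 y1 + exp_dd_kernel a p q x2 y2
           \<ge> exp_dd_kernel a p q x1 y2 + exp_dd_kernel a p q x2 y1"
proof -
  \<comment> \<open>By the telescoping identity, \<open>(x2 - x1) * S y\<close> is the increment of
    the kernel in x. It remains to see that \<open>S\<close> is monotone, which holds summand by
    summand.\<close>
  define S where "S = (\<lambda>y. \<Sum>i<p.
    exp_dd_real (replicate (p - i) x2 @ replicate (Suc i) x1 @ replicate q y @ a))"
  have "exp_dd_kernel a p q x y = exp_dd_real (replicate p x @ replicate q y @ a)" for x y
    unfolding exp_dd_kernel_def by (intro exp_dd_real_cong_mset) simp
  then have diff: "exp_dd_kernel a p q x2 y - exp_dd_kernel a p q x1 y = (x2 - x1) * S y" for y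
    by (simp add: exp_dd_real_replicate_diff S_def)
  have "S y1 \<le> S y2"
    unfolding S_def
  proof (rule sum_mono)
    fix i
    let ?b = "replicate (p - i) x2 @ replicate (Suc i) x1"
    \<comment> \<open>Symmetry brings the copies of y to the front, where monotonicity in a repeated
      node is available.\<close>
    have "exp_dd_real (?b @ replicate q y @ a) = exp_dd_real (replicate q y @ ?b @ a)" for y
      by (intro exp_dd_real_cong_mset) simp
    then show "exp_dd_real (replicate (p - i) x2 @ replicate (Suc i) x1 @ replicate q y1 @ a) \<le>
          exp_dd_real (replicate (p - i) x2 @ replicate (Suc i) x1 @ replicate q y2 @ a)"
      using exp_dd_real_replicate_mono[OF assms(5), of q "?b @ a"] by simp
  qed
  then have "(x2 - x1) * S y1 \<le> (x2 - x1) * S y2"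
    using assms(4) by (intro mult_left_mono) auto
  then show ?thesis
    using diff[of y1] diff[of y2] by linarith
qed

end
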